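(* Let $X$ be a nonempty zero-closed semigroup and let $I=\bigcap_{a\in X}XaX$. Then $X$ is polybounded if and only if $X$ admits a separable subinvariant pseudometric $d$ such that for some $o\in I$ and some real $\varepsilon>0$ the set $\{x\in I: d(x,o)<\varepsilon\}$ is polybounded in $X$.
   Context: For a semigroup $X$, the $0$-extension of $X$ is the semigroup $X^0=X\cup\{0\}$, where $0\notin X$ is a new element with $0x=0=x0$ for every $x\in X^0$; the $1$-extension of $X$ is the semigroup $X^1=X\cup\{1\}$, where $1\notin X$ is a new element with $1x=x=x1$ for every $x\in X^1$. A topology on a semigroup $S$ is a semigroup topology if the binary operation $S\times S\to S$ is continuous. A semigroup $X$ (carrying no topology) is zero-closed if $X$ is a closed subset of $X^0$ for every Hausdorff semigroup topology on $X^0$. A subset $A$ of a semigroup $X$ is algebraic if $A=\{x\in X: a_0xa_1x\cdots xa_n=b\}$ for some integer $n\ge 1$, some $b\in X$ and some $a_0,\dots,a_n\in X^1$. A subset $S\subseteq X$ is polybounded in $X$ if $S$ is contained in the union of finitely many algebraic subsets of $X$. A semigroup $X$ is polybounded if it is polybounded in itself. A pseudometric on $X$ is a function $d:X\times X\to\mathbb R$ with $d(x,x)=0$, $d(x,y)=d(y,x)$ and $d(x,z)\le d(x,y)+d(y,z)$ for all $x,y,z\in X$. It is separable if there is a countable set $C\subseteq X$ such that for every $x\in X$ and $\varepsilon>0$ there is $c\in C$ with $d(x,c)<\varepsilon$. It is subinvariant if $d(axb,ayb)\le d(x,y)$ for all $x,y\in X$ and $a,b\in X^1$. *)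

theory Defs
  imports "HOL-Analysis.Analysis"
begin

text \<open>
  A semigroup is a type of class \<open>semigroup_mult\<close>; it is nonempty because every type is.
  The extensions adjoin a genuinely new element, even if the semigroup already has a zero or a unit.
\<close>

datatype 'a zero_ext = Zero_ext | Inj0 'a

instantiation zero_ext :: (semigroup_mult) "{semigroup_mult, mult_zero}"
begin

definition zero_zero_ext :: "'a zero_ext" where
  "0 = Zero_ext"

fun times_zero_ext :: "'a zero_ext \<Rightarrow> 'a zero_ext \<Rightarrow> 'a zero_ext" where
  "Inj0 x * Inj0 y = Inj0 (x * y)"
| "Zero_ext * _ = Zero_ext"
| "_ * Zero_ext = Zero_ext"

instance
proof
  fix u v w :: "'a zero_ext"
  show "u * v * w = u * (v * w)"
    by (cases u; cases v; cases w) (simp_all add: mult.assoc)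
  show "0 * u = 0" "u * 0 = 0"
    by (cases u; simp add: zero_zero_ext_def)+
qed

end

datatype 'a one_ext = One_ext | Inj1 (out1: 'a)

instantiation one_ext :: (semigroup_mult) monoid_mult
begin

definition one_one_ext :: "'a one_ext" where
  "1 = One_ext"

fun times_one_ext :: "'a one_ext \<Rightarrow> 'a one_ext \<Rightarrow> 'a one_ext" where
  "Inj1 x * Inj1 y = Inj1 (x * y)"
| "One_ext * v = v"
| "u * One_ext = u"

instance
proof
  fix u v w :: "'a one_ext"
  show "u * v * w = u * (v * w)"
    by (cases u; cases v; cases w) (simp_all add: mult.assoc)
  show "1 * u = u" "u * 1 = u"
    by (cases u; simp add: one_one_ext_def)+
qed

end

definition semigroup_topology :: "'a::semigroup_mult topology \<Rightarrow> bool" where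
  "semigroup_topology T \<longleftrightarrow>
     topspace T = UNIV \<and> continuous_map (prod_topology T T) T (\<lambda>(x, y). x * y)"

definition zero_closed :: "'a::semigroup_mult itself \<Rightarrow> bool" where
  "zero_closed _ \<longleftrightarrow>
     (\<forall>T :: 'a zero_ext topology. semigroup_topology T \<and> Hausdorff_space T
        \<longrightarrow> closedin T (range Inj0))"

text \<open>\<open>sg_poly a n x\<close> is the product \<open>a 0 * x * a 1 * x * \<dots> * x * a n\<close>, with \<open>n\<close> occurrences of \<open>x\<close>.\<close>

primrec sg_poly :: "(nat \<Rightarrow> 'a one_ext) \<Rightarrow> nat \<Rightarrow> 'a::semigroup_mult \<Rightarrow> 'a one_ext" where
  "sg_poly a 0 x = a 0"
| "sg_poly a (Suc n) x = sg_poly a n x * Inj1 x * a (Suc n)"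

definition algebraic_set :: "'a::semigroup_mult set \<Rightarrow> bool" where
  "algebraic_set A \<longleftrightarrow> (\<exists>n\<ge>1. \<exists>a b. A = {x. sg_poly a n x = Inj1 b})"

definition polybounded :: "'a::semigroup_mult set \<Rightarrow> bool" where
  "polybounded S \<longleftrightarrow> (\<exists>F. finite F \<and> (\<forall>A\<in>F. algebraic_set A) \<and> S \<subseteq> \<Union>F)"

definition pseudometric :: "('a \<Rightarrow> 'a \<Rightarrow> real) \<Rightarrow> bool" where
  "pseudometric d \<longleftrightarrow>
     (\<forall>x. d x x = 0) \<and> (\<forall>x y. d x y = d y x) \<and> (\<forall>x y z. d x z \<le> d x y + d y z)"

definition separable_pseudometric :: "('a \<Rightarrow> 'a \<Rightarrow> real) \<Rightarrow> bool" where
  "separable_pseudometric d \<longleftrightarrow>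
     (\<exists>C. countable C \<and> (\<forall>x. \<forall>\<epsilon>>0. \<exists>c\<in>C. d x c < \<epsilon>))"

text \<open>
  The multipliers \<open>a\<close> and \<open>b\<close> may be the adjoined unit, so \<open>a x b\<close> is computed in the
  \<open>1\<close>-extension and then read back as an element of the semigroup; by the next lemma it always is one.
\<close>

lemma Inj1_out1_mult [simp]:
  fixes x :: "'a::semigroup_mult"
  shows "Inj1 (out1 (a * Inj1 x * b)) = a * Inj1 x * b"
  by (cases a; cases b) simp_all

definition subinvariant :: "('a::semigroup_mult \<Rightarrow> 'a \<Rightarrow> real) \<Rightarrow> bool" where
  "subinvariant d \<longleftrightarrow>
     (\<forall>x y a b. d (out1 (a * Inj1 x * b)) (out1 (a * Inj1 y * b)) \<le> d x y)"

end

theory Submission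
  imports Defs
begin

text \<open>
  If \<open>X\<close> is polybounded, the zero pseudometric works as soon as \<open>I\<close> is nonempty. Every \<open>x\<close> divides
  the right-hand side \<open>b\<close> of an equation that it satisfies, so a common multiple of the finitely many
  right-hand sides of a cover by algebraic sets is a multiple of every element of \<open>X\<close>, that is, an
  element of \<open>I\<close> (\<open>polybounded_imp_core_nonempty\<close>).

  For the converse, \<open>I\<close> is an ideal, and \<open>x \<mapsto> x * c\<close> with \<open>c \<in> I\<close> maps \<open>X\<close> into \<open>I\<close>. Preimages of
  polybounded sets under nonconstant polynomial maps are polybounded, so it is enough to show that
  \<open>I\<close> is polybounded. Suppose that it is not. Then finitely many nonconstant polynomial maps can
  never send all of \<open>I\<close> into the polybounded ball \<open>B = {x \<in> I. d x c < \<epsilon>}\<close>: some \<open>y \<in> I\<close> is sent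
  outside \<open>B\<close> by all of them. Using this infinitely often yields a sequence \<open>x\<close> in \<open>I\<close> such that no
  word in the \<open>x k\<close> and in a countable dense set lies in \<open>B\<close>, provided that only words of a controlled
  shape are considered, of which finitely many have a given last variable
  (\<open>exists_words_avoiding\<close>). The words fall into levels \<open>W n\<close>, where products of two words of level
  \<open>n + 1\<close> have level \<open>n\<close>, and where multiplication by a fixed dense element lowers a high enough level
  only to a prescribed \<open>n\<close>.

  Now fatten \<open>W n\<close> to \<open>U n\<close>, its \<open>\<epsilon> / 2 ^ n\<close>-neighbourhood. By subinvariance, the sets
  \<open>{0} \<union> U n\<close> are neighbourhoods of zero of a semigroup topology on the zero-extension in which the
  points of \<open>X\<close> are isolated; density of the chosen countable set is what handles multiplication by an
  arbitrary element of \<open>X\<close>. This topology is Hausdorff: a point \<open>a\<close> in all \<open>U n\<close> would bring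
  \<open>c = u * a * v\<close> into \<open>U 0\<close>, whereas the words stay at distance at least \<open>\<epsilon>\<close> from \<open>c\<close>. As no
  \<open>U n\<close> is empty, \<open>X\<close> is not closed, so \<open>X\<close> is not zero-closed
  (\<open>zero_closed_no_vanishing_sequence\<close>).
\<close>

section \<open>Polynomial maps and polybounded sets\<close>

text \<open>
  The values lie in the \<open>1\<close>-extension so that the constant map \<open>1\<close>, needed to break a polynomial into
  factors, is itself a polynomial map of degree \<open>0\<close>.
\<close>
definition poly_map :: "nat \<Rightarrow> ('a::semigroup_mult \<Rightarrow> 'a one_ext) \<Rightarrow> bool" where
  "poly_map n f \<longleftrightarrow> (\<exists>a. \<forall>x. f x = sg_poly a n x)"

lemma sg_poly_cong:
  "(\<And>i. i \<le> n \<Longrightarrow> a i = b i) \<Longrightarrow> sg_poly a n x = sg_poly b n x"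
  by (induction n) auto

lemma poly_map_const: "poly_map 0 (\<lambda>_. u)"
  unfolding poly_map_def by (rule exI[of _ "\<lambda>_. u"]) simp

lemma poly_map_Inj1: "poly_map 1 Inj1"
  unfolding poly_map_def by (rule exI[of _ "\<lambda>_. 1"]) simp

lemma poly_map_mult:
  assumes "poly_map n f" "poly_map m g"
  shows "poly_map (n + m) (\<lambda>x. f x * g x)"
proof -
  obtain a b where a: "\<And>x. f x = sg_poly a n x" and b: "\<And>x. g x = sg_poly b m x"
    using assms unfolding poly_map_def by metis
  \<comment> \<open>Concatenate the coefficients; the last one of \<open>f\<close> and the first one of \<open>g\<close> become adjacent and
    merge into one.\<close>
  define e where "e i = (if i < n then a i else if i = n then a n * b 0 else b (i - n))" for i
  have e: "i < n \<Longrightarrow> e i = a i" "e n = a n * b 0" "e (n + Suc j) = b (Suc j)" for i j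
    by (simp_all add: e_def)
  have left: "sg_poly e n x = sg_poly a n x * b 0" for x
  proof (cases n)
    case 0
    then show ?thesis using e(2) by simp
  next
    case (Suc k)
    have "sg_poly e k x = sg_poly a k x"
      by (rule sg_poly_cong) (simp add: e Suc)
    then show ?thesis
      using e(2) by (simp add: Suc mult.assoc)
  qed
  have "sg_poly e (n + j) x = sg_poly a n x * sg_poly b j x" for j x
  proof (induction j)
    case (Suc j)
    then show ?case using e(3)[of j] by (simp add: mult.assoc)
  qed (simp add: left)
  then show ?thesis
    unfolding poly_map_def a b by (intro exI[of _ e]) simp
qed

lemma poly_map_compose:
  assumes "poly_map m (\<lambda>x. Inj1 (f x))"
  shows "poly_map (n * m) (\<lambda>x. sg_poly a n (f x))"
proof (induction n)
  case 0
  show ?case by (simp add: poly_map_const)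
next
  case (Suc n)
  have "poly_map (n * m + m + 0) (\<lambda>x. sg_poly a n (f x) * Inj1 (f x) * a (Suc n))"
    by (intro poly_map_mult Suc assms poly_map_const)
  then show ?case by (simp add: add.commute)
qed

lemma polybounded_subset: "polybounded T \<Longrightarrow> S \<subseteq> T \<Longrightarrow> polybounded S"
  unfolding polybounded_def by (meson order_trans)

lemma polybounded_UN:
  assumes "finite J" "\<And>j. j \<in> J \<Longrightarrow> polybounded (S j)"
  shows "polybounded (\<Union>j\<in>J. S j)"
proof -
  have "\<forall>j\<in>J. \<exists>F. finite F \<and> (\<forall>A\<in>F. algebraic_set A) \<and> S j \<subseteq> \<Union>F"
    using assms(2) unfolding polybounded_def by blast
  from bchoice[OF this] obtain F
    where F: "\<forall>j\<in>J. finite (F j) \<and> (\<forall>A\<in>F j. algebraic_set A) \<and> S j \<subseteq> \<Union>(F j)" ..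
  have "(\<Union>j\<in>J. S j) \<subseteq> \<Union>(\<Union>j\<in>J. F j)"
    using F by fastforce
  moreover have "finite (\<Union>j\<in>J. F j)" "\<forall>A\<in>\<Union>j\<in>J. F j. algebraic_set A"
    using F assms(1) by simp_all
  ultimately show ?thesis unfolding polybounded_def by blast
qed

text \<open>
  Substituting a polynomial of degree \<open>m\<close> into one of degree \<open>n\<close> gives degree \<open>n * m\<close>. Positivity of
  \<open>m\<close> keeps the degree positive, as the definition of algebraic sets demands.
\<close>
lemma algebraic_set_vimage:
  assumes "algebraic_set A" "poly_map m (\<lambda>x. Inj1 (f x))" "m \<ge> 1"
  shows "algebraic_set (f -` A)"
proof -
  obtain n a b where n: "n \<ge> 1" and A: "A = {x. sg_poly a n x = Inj1 b}"
    using assms(1) unfolding algebraic_set_def by blast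
  obtain e where "\<And>x. sg_poly a n (f x) = sg_poly e (n * m) x"
    using poly_map_compose[OF assms(2)] unfolding poly_map_def by metis
  then have "f -` A = {x. sg_poly e (n * m) x = Inj1 b}"
    by (simp add: A vimage_def)
  moreover have "n * m \<ge> 1" using n assms(3) by simp
  ultimately show ?thesis unfolding algebraic_set_def by blast
qed

lemma polybounded_vimage:
  assumes "polybounded S" "poly_map m (\<lambda>x. Inj1 (f x))" "m \<ge> 1"
  shows "polybounded (f -` S)"
proof -
  obtain F where "finite F" "\<forall>A\<in>F. algebraic_set A" "S \<subseteq> \<Union>F"
    using assms(1) unfolding polybounded_def by blast
  then show ?thesis
    unfolding polybounded_def
    by (intro exI[of _ "(-`) f ` F"]) (use algebraic_set_vimage[OF _ assms(2,3)] in fastforce)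
qed

section \<open>The least ideal of a polybounded semigroup\<close>

text \<open>
  A new element is put in front three times: the middle copy is the required factor, and the other two
  provide the outer factors, which have to lie in the semigroup itself rather than in its
  \<open>1\<close>-extension.
\<close>
lemma common_multiple:
  fixes S :: "'a::semigroup_mult set"
  assumes "finite S"
  shows "\<exists>c. \<forall>b\<in>S. \<exists>u v. c = u * b * v"
  using assms
proof (induction S rule: finite_induct)
  case (insert b S)
  then obtain c where c: "\<forall>b\<in>S. \<exists>u v. c = u * b * v" by blast
  have "\<exists>u v. b * b * b * c = u * b' * v" if b': "b' \<in> insert b S" for b'
  proof (cases "b' = b")
    case True
    then have "b * b * b * c = b * b' * (b * c)" by (simp add: mult.assoc)
    then show ?thesis by blast
  next
    case False
    then obtain u v where "c = u * b' * v" using b' c by blast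
    then have "b * b * b * c = (b * b * b * u) * b' * v" by (simp add: mult.assoc)
    then show ?thesis by blast
  qed
  then show ?case by blast
qed simp

lemma core_ideal:
  fixes u :: "'a::semigroup_mult"
  assumes u: "u \<in> (\<Inter>a. {x * a * y | x y. True})"
  shows "b * u \<in> (\<Inter>a. {x * a * y | x y. True})"
    and "u * b \<in> (\<Inter>a. {x * a * y | x y. True})"
proof -
  have "(\<exists>x y. b * u = x * a * y) \<and> (\<exists>x y. u * b = x * a * y)" for a
  proof -
    obtain x y where "u = x * a * y" using u by blast
    then have "b * u = (b * x) * a * y" "u * b = x * a * (y * b)"
      by (simp_all add: mult.assoc)
    then show ?thesis by blast
  qed
  then show "b * u \<in> (\<Inter>a. {x * a * y | x y. True})"
    and "u * b \<in> (\<Inter>a. {x * a * y | x y. True})" by blast+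
qed

text \<open>
  A common multiple of the right-hand sides of the equations in a finite algebraic cover is a multiple
  of every \<open>a\<close>, because \<open>a\<close> solves one of these equations.
\<close>
lemma polybounded_imp_core_nonempty:
  assumes "polybounded (UNIV :: 'a::semigroup_mult set)"
  shows "(\<Inter>a::'a. {x * a * y | x y. True}) \<noteq> {}"
proof -
  obtain F :: "'a set set" where F: "finite F" "\<forall>A\<in>F. algebraic_set A" "UNIV \<subseteq> \<Union>F"
    using assms unfolding polybounded_def by blast
  \<comment> \<open>Since the degree is positive, a solution divides the right-hand side of its equation.\<close>
  have "\<forall>A\<in>F. \<exists>b. \<forall>x\<in>A. \<exists>s t. s * Inj1 x * t = Inj1 b"
  proof
    fix A assume "A \<in> F"
    then obtain n a b where n: "n \<ge> 1" and A: "A = {x. sg_poly a n x = Inj1 b}"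
      using F(2) unfolding algebraic_set_def by blast
    then show "\<exists>b. \<forall>x\<in>A. \<exists>s t. s * Inj1 x * t = Inj1 b"
      by (cases n) auto
  qed
  then obtain b where b: "\<And>A x. A \<in> F \<Longrightarrow> x \<in> A \<Longrightarrow> \<exists>s t. s * Inj1 x * t = Inj1 (b A)"
    by metis
  obtain c where c: "\<forall>b'\<in>b ` F. \<exists>u v. c = u * b' * v"
    using common_multiple F(1) by blast
  have "\<exists>u v. c = u * a * v" for a
  proof -
    obtain A where "A \<in> F" "a \<in> A" using F(3) by blast
    then obtain s t u v where st: "s * Inj1 a * t = Inj1 (b A)" and uv: "c = u * b A * v"
      using b c by blast
    have "Inj1 c = Inj1 u * (s * Inj1 a * t) * Inj1 v"
      by (simp add: st uv)
    also have "\<dots> = (Inj1 u * s) * Inj1 a * (t * Inj1 v)"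
      by (simp add: mult.assoc)
    also obtain u' where "Inj1 u * s = Inj1 u'" by (cases s) auto
    also obtain v' where "t * Inj1 v = Inj1 v'" by (cases t) auto
    finally show ?thesis by auto
  qed
  then show ?thesis by blast
qed

section \<open>Topologies on the zero-extension given by neighbourhoods of zero\<close>

text \<open>
  The conditions on products say exactly that the sets \<open>{0} \<union> U n\<close>, taken as neighbourhoods of zero
  while all other points are isolated, make the multiplication of the zero-extension continuous. If the
  sets \<open>U n\<close> had empty intersection, the topology would be Hausdorff; but zero would be a limit of
  \<open>X\<close>, as each \<open>U n\<close> is nonempty.
\<close>
lemma zero_closed_no_vanishing_sequence:
  fixes U :: "nat \<Rightarrow> 'a::semigroup_mult set"
  assumes zc: "zero_closed TYPE('a)"
    and dec: "decseq U" and ne: "\<And>n. U n \<noteq> {}"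
    and sq: "\<And>n. \<exists>m. \<forall>x\<in>U m. \<forall>y\<in>U m. x * y \<in> U n"
    and left: "\<And>a n. \<exists>m. \<forall>x\<in>U m. a * x \<in> U n"
    and right: "\<And>a n. \<exists>m. \<forall>x\<in>U m. x * a \<in> U n"
  shows "(\<Inter>n. U n) \<noteq> {}"
proof
  assume vanish: "(\<Inter>n. U n) = {}"
  define opn where "opn S \<longleftrightarrow> (Zero_ext \<in> S \<longrightarrow> (\<exists>n. Inj0 ` U n \<subseteq> S))" for S :: "'a zero_ext set"
  define T where "T = topology opn"
  have "istopology opn"
    unfolding istopology_def
  proof (intro conjI allI impI)
    fix S S' assume S: "opn S" "opn S'"
    show "opn (S \<inter> S')"
      unfolding opn_def
    proof
      assume "Zero_ext \<in> S \<inter> S'"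
      then obtain n m where "Inj0 ` U n \<subseteq> S" "Inj0 ` U m \<subseteq> S'"
        using S unfolding opn_def by blast
      moreover have "U (max n m) \<subseteq> U n" "U (max n m) \<subseteq> U m"
        using dec by (simp_all add: decseq_def)
      ultimately show "\<exists>k. Inj0 ` U k \<subseteq> S \<inter> S'"
        by (intro exI[of _ "max n m"]) blast
    qed
  next
    fix K assume K: "\<forall>S\<in>K. opn S"
    show "opn (\<Union>K)"
      unfolding opn_def
    proof
      assume "Zero_ext \<in> \<Union>K"
      then obtain S where "S \<in> K" "Zero_ext \<in> S" by blast
      then obtain n where "Inj0 ` U n \<subseteq> S" using K unfolding opn_def by blast
      then show "\<exists>n. Inj0 ` U n \<subseteq> \<Union>K" using \<open>S \<in> K\<close> by blast
    qed
  qed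
  then have opn: "openin T S \<longleftrightarrow> opn S" for S
    by (simp add: T_def topology_inverse')
  have point: "openin T {Inj0 x}" for x
    by (simp add: opn opn_def)
  have nbhd: "openin T (insert Zero_ext (Inj0 ` U n))" for n
    by (auto simp: opn opn_def)
  have top: "topspace T = UNIV"
    using openin_subset[of T UNIV] by (auto simp: opn opn_def)
  have "Hausdorff_space T"
    unfolding Hausdorff_space_def
  proof (intro allI impI)
    fix p q assume "p \<in> topspace T \<and> q \<in> topspace T \<and> p \<noteq> q"
    then have pq: "p \<noteq> q" by simp
    have sep: "\<exists>V W. openin T V \<and> openin T W \<and> Zero_ext \<in> V \<and> Inj0 x \<in> W \<and> disjnt V W" for x
    proof -
      obtain n where "x \<notin> U n" using vanish by blast
      then have "disjnt (insert Zero_ext (Inj0 ` U n)) {Inj0 x}" by auto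
      then show ?thesis using nbhd point by blast
    qed
    show "\<exists>V W. openin T V \<and> openin T W \<and> p \<in> V \<and> q \<in> W \<and> disjnt V W"
    proof (cases p)
      case Zero_ext
      then show ?thesis using pq sep by (cases q) auto
    next
      case (Inj0 x)
      show ?thesis
      proof (cases q)
        case Zero_ext
        then show ?thesis using sep[of x] Inj0 by (metis disjnt_sym)
      next
        fix y assume "q = Inj0 y"
        then have "disjnt {p} {q}" "openin T {p}" "openin T {q}"
          using pq point Inj0 by auto
        then show ?thesis by blast
      qed
    qed
  qed
  moreover have "semigroup_topology T"
    unfolding semigroup_topology_def
  proof (intro conjI top)
    have "openin (prod_topology T T) {z. (\<lambda>(x, y). x * y) z \<in> S}" if S: "openin T S" for S
      unfolding openin_prod_topology_alt
    proof (intro allI impI)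
      fix p q assume "(p, q) \<in> {z. (\<lambda>(x, y). x * y) z \<in> S}"
      then have pq: "p * q \<in> S" by simp
      have "\<exists>V W. openin T V \<and> openin T W \<and> p \<in> V \<and> q \<in> W \<and> (\<forall>v\<in>V. \<forall>w\<in>W. v * w \<in> S)"
      proof (cases "Zero_ext \<in> {p, q}")
        case False
        then obtain x y where "p = Inj0 x" "q = Inj0 y"
          by (cases p; cases q) auto
        then show ?thesis
          using pq by (intro exI[of _ "{p}"] exI[of _ "{q}"]) (simp add: point)
      next
        case True
        then have "Zero_ext \<in> S"
          using pq by (cases p; cases q) auto
        then obtain n where n: "Inj0 ` U n \<subseteq> S"
          using S unfolding opn opn_def by blast
        have mem: "v * w \<in> S" if "v = Zero_ext \<or> w = Zero_ext" for v w
          using that \<open>Zero_ext \<in> S\<close> by (cases v; cases w) auto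
        show ?thesis
        proof (cases p)
          case p: Zero_ext
          show ?thesis
          proof (cases q)
            case q: Zero_ext
            obtain m where "\<forall>x\<in>U m. \<forall>y\<in>U m. x * y \<in> U n" using sq by blast
            then show ?thesis
              using n mem \<open>Zero_ext \<in> S\<close> p q nbhd[of m]
              by (intro exI[of _ "insert Zero_ext (Inj0 ` U m)"]) auto
          next
            case q: (Inj0 a)
            obtain m where "\<forall>x\<in>U m. x * a \<in> U n" using right by blast
            then show ?thesis
              using n mem \<open>Zero_ext \<in> S\<close> p q nbhd[of m] point[of a]
              by (intro exI[of _ "insert Zero_ext (Inj0 ` U m)"] exI[of _ "{q}"]) auto
          qed
        next
          case p: (Inj0 a)
          then have q: "q = Zero_ext" using True by auto
          obtain m where "\<forall>x\<in>U m. a * x \<in> U n" using left by blast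
          then show ?thesis
            using n mem \<open>Zero_ext \<in> S\<close> p q nbhd[of m] point[of a]
            by (intro exI[of _ "{p}"] exI[of _ "insert Zero_ext (Inj0 ` U m)"]) auto
        qed
      qed
      then show "\<exists>V W. openin T V \<and> openin T W \<and> p \<in> V \<and> q \<in> W \<and>
          V \<times> W \<subseteq> {z. (\<lambda>(x, y). x * y) z \<in> S}"
        by fastforce
    qed
    then show "continuous_map (prod_topology T T) T (\<lambda>(x, y). x * y)"
      by (simp add: continuous_map_def top)
  qed
  ultimately have "closedin T (range Inj0)"
    using zc unfolding zero_closed_def by blast
  then have "opn (UNIV - range Inj0)"
    by (simp add: closedin_def top opn)
  then have "\<exists>n. Inj0 ` U n \<subseteq> UNIV - range Inj0"
    unfolding opn_def by auto
  then show False using ne by blast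
qed

section \<open>Sets of words that avoid a polybounded set\<close>

text \<open>
  The words of one level other than its new variable, obtained from the set \<open>T\<close> of words of the next level and the set \<open>K\<close> of
  constants allowed at this level.
\<close>
definition word_step :: "'a::semigroup_mult set \<Rightarrow> 'a set \<Rightarrow> 'a set" where
  "word_step K T = T \<union> (\<lambda>(u, v). u * v) ` (T \<times> (T \<union> K) \<union> K \<times> T)"

text \<open>
  The words of level \<open>n\<close> in the variables \<open>x n, \<dots>, x (n + r - 1)\<close>. A constant \<open>c j\<close> may be used only at
  levels \<open>n \<ge> j\<close>, and a variable \<open>x k\<close> enters at level \<open>k\<close>. Hence every \<open>words c x n r\<close> is finite,
  while for each \<open>j\<close> all words of level above \<open>j\<close> can be multiplied by \<open>c j\<close>. The full level is the
  union over \<open>r\<close>.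
\<close>
primrec words :: "(nat \<Rightarrow> 'a) \<Rightarrow> (nat \<Rightarrow> 'a) \<Rightarrow> nat \<Rightarrow> nat \<Rightarrow> 'a::semigroup_mult set" where
  "words c x n 0 = {}"
| "words c x n (Suc r) = insert (x n) (word_step (c ` {..n}) (words c x (Suc n) r))"

lemma word_step_mono: "T \<subseteq> T' \<Longrightarrow> word_step K T \<subseteq> word_step K T'"
  unfolding word_step_def by (intro Un_mono image_mono Sigma_mono) auto

lemma finite_words: "finite (words c x n r)"
  by (induction r arbitrary: n) (simp_all add: word_step_def)

lemma words_cong:
  "(\<And>i. n \<le> i \<Longrightarrow> i < n + r \<Longrightarrow> x i = y i) \<Longrightarrow> words c x n r = words c y n r"
proof (induction r arbitrary: n)
  case (Suc r)
  have "words c x (Suc n) r = words c y (Suc n) r"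
    by (rule Suc.IH) (simp add: Suc.prems)
  then show ?case using Suc.prems[of n] by simp
qed simp

lemma words_mono_Suc: "words c x n r \<subseteq> words c x n (Suc r)"
proof (induction r arbitrary: n)
  case (Suc r)
  show ?case
    using word_step_mono[OF Suc[of "Suc n"], of "c ` {..n}"] by auto
qed simp

lemma words_mono: "r \<le> s \<Longrightarrow> words c x n r \<subseteq> words c x n s"
  by (rule lift_Suc_mono_le[of "words c x n"]) (rule words_mono_Suc)

lemma words_subset_ideal:
  assumes "\<And>i. n \<le> i \<Longrightarrow> i < n + r \<Longrightarrow> x i \<in> I"
    and "\<And>u a. u \<in> I \<Longrightarrow> a * u \<in> I" "\<And>u a. u \<in> I \<Longrightarrow> u * a \<in> I"
  shows "words c x n r \<subseteq> I"
  using assms(1)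
proof (induction r arbitrary: n)
  case (Suc r)
  have "words c x (Suc n) r \<subseteq> I"
    by (rule Suc.IH) (simp add: Suc.prems)
  then show ?case using Suc.prems[of n] assms(2,3) by (auto simp: word_step_def)
qed simp

text \<open>
  A word in which the last variable occurs depends on that variable through a nonconstant polynomial.
  As a function of the last variable, a factor of such a word is therefore either a member of the
  finite family \<open>P\<close> or constant, and at least one of the two factors of a product lies in \<open>P\<close>.
\<close>
lemma words_last_variable:
  assumes "k = n + r"
  shows "\<exists>P. finite P \<and> (\<forall>f\<in>P. \<exists>m\<ge>1. poly_map m (\<lambda>y. Inj1 (f y))) \<and>
    (\<forall>y. words c (x(k := y)) n (Suc r) \<subseteq> words c x n r \<union> (\<lambda>f. f y) ` P)"
  using assms
proof (induction r arbitrary: n)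
  case 0
  then show ?case
    using poly_map_Inj1 by (intro exI[of _ "{\<lambda>y. y}"]) (auto simp: word_step_def)
next
  case (Suc r)
  define O' where "O' = words c x (Suc n) r"
  define K where "K = c ` {..n}"
  obtain P where P: "finite P" "\<And>f. f \<in> P \<Longrightarrow> \<exists>m\<ge>1. poly_map m (\<lambda>y. Inj1 (f y))"
    "\<And>y. words c (x(k := y)) (Suc n) (Suc r) \<subseteq> O' \<union> (\<lambda>f. f y) ` P"
    using Suc.IH[of "Suc n"] Suc.prems unfolding O'_def by (metis add_Suc add_Suc_right)
  \<comment> \<open>All factors that may occur in a product: the nonconstant ones and the constants.\<close>
  define Q where "Q = P \<union> (\<lambda>a _. a) ` (O' \<union> K)"
  define P' where "P' = P \<union> (\<lambda>(f, g) y. f y * g y) ` (P \<times> Q \<union> Q \<times> P)"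
  have "finite P'"
    by (simp add: P'_def Q_def P(1) O'_def K_def finite_words)
  moreover have "\<exists>m\<ge>1. poly_map m (\<lambda>y. Inj1 (f y))" if "f \<in> P'" for f
  proof -
    have Q: "\<exists>m. poly_map m (\<lambda>y. Inj1 (g y))" if "g \<in> Q" for g
      using that P(2)[of g] poly_map_const unfolding Q_def by auto
    have prod: "\<exists>m\<ge>1. poly_map m (\<lambda>y. Inj1 (g y * h y))"
      if "poly_map i (\<lambda>y. Inj1 (g y))" "poly_map j (\<lambda>y. Inj1 (h y))" "i \<ge> 1 \<or> j \<ge> 1" for g h :: "'a \<Rightarrow> 'a" and i j
      using poly_map_mult[OF that(1,2)] that(3) by (intro exI[of _ "i + j"]) auto
    consider "f \<in> P" | g h where "f = (\<lambda>y. g y * h y)" "g \<in> P" "h \<in> Q"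
      | g h where "f = (\<lambda>y. g y * h y)" "g \<in> Q" "h \<in> P"
      using \<open>f \<in> P'\<close> unfolding P'_def by auto
    then show ?thesis
    proof cases
      case 1
      then show ?thesis by (rule P(2))
    next
      case (2 g h)
      then show ?thesis using P(2)[OF 2(2)] Q[OF 2(3)] prod by blast
    next
      case (3 g h)
      then show ?thesis using Q[OF 3(2)] P(2)[OF 3(3)] prod by blast
    qed
  qed
  moreover have "words c (x(k := y)) n (Suc (Suc r)) \<subseteq> words c x n (Suc r) \<union> (\<lambda>f. f y) ` P'" for y
  proof -
    let ?V = "(\<lambda>f. f y) ` P"
    have prods: "u * v \<in> (\<lambda>f. f y) ` P'"
      if "u \<in> ?V \<and> v \<in> O' \<union> K \<union> ?V \<or> u \<in> O' \<union> K \<union> ?V \<and> v \<in> ?V" for u v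
    proof -
      have V: "O' \<union> K \<union> ?V = (\<lambda>f. f y) ` Q"
        by (auto simp: Q_def image_Un image_image)
      obtain f g where "(f, g) \<in> P \<times> Q \<union> Q \<times> P" "u = f y" "v = g y"
        using \<open>_ \<or> _\<close> unfolding V by blast
      then show ?thesis
        unfolding P'_def by (intro image_eqI[of _ _ "\<lambda>y. f y * g y"]) auto
    qed
    have "words c (x(k := y)) n (Suc (Suc r)) \<subseteq> insert (x n) (word_step K (O' \<union> ?V))"
      using word_step_mono[OF P(3)[of y], of K] Suc.prems by (auto simp: K_def)
    also have "\<dots> \<subseteq> insert (x n) (word_step K O') \<union> (\<lambda>f. f y) ` P'"
    proof -
      have "u * v \<in> word_step K O' \<union> (\<lambda>f. f y) ` P'"
        if "(u, v) \<in> (O' \<union> ?V) \<times> ((O' \<union> ?V) \<union> K) \<union> K \<times> (O' \<union> ?V)" for u v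
      proof (cases "u \<in> ?V \<or> v \<in> ?V")
        case True
        then show ?thesis using prods[of u v] that by blast
      next
        case False
        then have "(u, v) \<in> O' \<times> (O' \<union> K) \<union> K \<times> O'" using that by blast
        then show ?thesis unfolding word_step_def by force
      qed
      then have "(\<lambda>(u, v). u * v) ` ((O' \<union> ?V) \<times> ((O' \<union> ?V) \<union> K) \<union> K \<times> (O' \<union> ?V))
          \<subseteq> word_step K O' \<union> (\<lambda>f. f y) ` P'"
        by (intro image_subsetI) (simp only: split_paired_all prod.case)
      moreover have "O' \<subseteq> word_step K O'"
        by (simp add: word_step_def)
      moreover have "?V \<subseteq> (\<lambda>f. f y) ` P'"
        by (auto simp: P'_def)
      ultimately have "word_step K (O' \<union> ?V) \<subseteq> word_step K O' \<union> (\<lambda>f. f y) ` P'"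
        unfolding word_step_def[of K "O' \<union> ?V"] by (meson Un_least Un_upper1 Un_upper2 order_trans)
      then show ?thesis by blast
    qed
    finally show ?thesis by (simp add: O'_def K_def)
  qed
  ultimately show ?case by blast
qed

text \<open>
  The variables are chosen one at a time. The words without the new variable avoid \<open>B\<close> already. The
  others are the values of finitely many nonconstant polynomials, so the forbidden choices form a
  polybounded set, which cannot contain all of \<open>I\<close>.
\<close>
lemma exists_words_avoiding:
  fixes I B :: "'a::semigroup_mult set"
  assumes "\<not> polybounded I" "polybounded B"
  shows "\<exists>x. (\<forall>k. x k \<in> I) \<and> (\<forall>r. words c x 0 r \<inter> B = {})"
proof -
  define ok where "ok x k y \<longleftrightarrow> y \<in> I \<and> words c (x(k := y)) 0 (Suc k) \<inter> B = {}" for x k y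
  have "\<exists>x. \<forall>k. ok x k (x k)"
  proof (rule dependent_wellorder_choice)
    fix k y and x x' :: "nat \<Rightarrow> 'a"
    assume "\<And>i. i < k \<Longrightarrow> x i = x' i"
    then have "words c (x(k := y)) 0 (Suc k) = words c (x'(k := y)) 0 (Suc k)"
      by (intro words_cong) auto
    then show "ok x k y = ok x' k y" by (simp only: ok_def)
  next
    fix k and x :: "nat \<Rightarrow> 'a"
    assume prev: "\<And>i. i < k \<Longrightarrow> ok x i (x i)"
    have old: "words c x 0 k \<inter> B = {}"
      using prev[of "k - 1"] by (cases k) (simp_all add: ok_def)
    obtain P where P: "finite P" "\<forall>f\<in>P. \<exists>m\<ge>1. poly_map m (\<lambda>y. Inj1 (f y))"
      "\<And>y. words c (x(k := y)) 0 (Suc k) \<subseteq> words c x 0 k \<union> (\<lambda>f. f y) ` P"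
      using words_last_variable[of k 0 k c x] by auto
    have "polybounded (\<Union>f\<in>P. f -` B)"
      by (rule polybounded_UN[OF P(1)]) (use P(2) polybounded_vimage[OF assms(2)] in blast)
    then have "\<not> I \<subseteq> (\<Union>f\<in>P. f -` B)"
      using assms(1) polybounded_subset by metis
    then obtain y where "y \<in> I" "\<forall>f\<in>P. f y \<notin> B"
      by blast
    then show "\<exists>y. ok x k y"
      unfolding ok_def using old P(3)[of y] by blast
  qed
  then obtain x where x: "\<And>k. ok x k (x k)" by blast
  have "words c x 0 r \<inter> B = {}" for r
    using x[of "r - 1"] by (cases r) (simp_all add: ok_def)
  then show ?thesis using x unfolding ok_def by blast
qed

section \<open>Subinvariant pseudometrics on zero-closed semigroups\<close>

lemma subinvariant_mult:
  assumes "subinvariant d"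
  shows "d (a * x) (a * y) \<le> d x y" "d (x * a) (y * a) \<le> d x y"
  using assms[unfolded subinvariant_def, rule_format, of "Inj1 a" x One_ext y]
    assms[unfolded subinvariant_def, rule_format, of One_ext x "Inj1 a" y] by simp_all

lemma subinvariant_mult2:
  assumes "pseudometric d" "subinvariant d"
  shows "d (x * y) (x' * y') \<le> d x x' + d y y'"
proof -
  have "d (x * y) (x' * y') \<le> d (x * y) (x' * y) + d (x' * y) (x' * y')"
    using assms(1) unfolding pseudometric_def by blast
  then show ?thesis
    using subinvariant_mult[OF assms(2)] by (smt (verit))
qed

text \<open>
  The levels of words that avoid the ball around \<open>p\<close> are enlarged to neighbourhoods with respect to
  \<open>d\<close>. Halving the radius from level to level absorbs the two errors in
  \<open>d (u * v) (u' * v') \<le> d u u' + d v v'\<close>.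
\<close>
lemma zero_closed_polybounded_core:
  fixes d :: "'a::semigroup_mult \<Rightarrow> 'a \<Rightarrow> real"
  assumes zc: "zero_closed TYPE('a)"
    and I: "I = (\<Inter>a. {x * a * y | x y. True})"
    and d: "pseudometric d" "separable_pseudometric d" "subinvariant d"
    and o: "p \<in> I" "\<epsilon> > 0" "polybounded {x\<in>I. d x p < \<epsilon>}"
  shows "polybounded I"
proof (rule ccontr)
  assume npb: "\<not> polybounded I"
  have ideal: "a * u \<in> I" "u * a \<in> I" if "u \<in> I" for u a
    using that unfolding I by (rule core_ideal)+
  obtain C where C: "countable C" "\<And>x \<epsilon>. \<epsilon> > 0 \<Longrightarrow> \<exists>c\<in>C. d x c < \<epsilon>"
    using d(2) unfolding separable_pseudometric_def by blast
  have "C \<noteq> {}" using C(2)[of 1] by auto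
  define c where "c = from_nat_into C"
  have range_c: "range c = C"
    unfolding c_def using \<open>C \<noteq> {}\<close> C(1) by (rule range_from_nat_into)
  obtain x where x: "\<And>k. x k \<in> I" "\<And>r. words c x 0 r \<inter> {x\<in>I. d x p < \<epsilon>} = {}"
    using exists_words_avoiding[OF npb o(3)] by metis
  define W where "W n = (\<Union>r. words c x n r)" for n
  have WI: "W n \<subseteq> I" for n
    unfolding W_def using words_subset_ideal[of _ _ x I c] x(1) ideal by blast
  have step: "word_step (c ` {..n}) (words c x (Suc n) r) \<subseteq> W n" for n r
    unfolding W_def by (rule order_trans[OF _ UN_upper[of "Suc r"]]) auto
  have W_x: "x n \<in> W n" for n
    unfolding W_def by (intro UN_I[of 1]) auto
  have W_Suc: "W (Suc n) \<subseteq> W n" for n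
    using step[of n] by (fastforce simp: W_def[of "Suc n"] word_step_def)
  have W_mult: "u * v \<in> W n" if uv: "u \<in> W (Suc n)" "v \<in> W (Suc n)" for u v n
  proof -
    obtain r s where "u \<in> words c x (Suc n) r" "v \<in> words c x (Suc n) s"
      using uv unfolding W_def by blast
    then have "u \<in> words c x (Suc n) (max r s)" "v \<in> words c x (Suc n) (max r s)"
      using words_mono[of _ "max r s" c x "Suc n"] by (meson max.cobounded1 max.cobounded2 subsetD)+
    then show ?thesis using step[of n "max r s"] by (force simp: word_step_def)
  qed
  have W_dec: "W m \<subseteq> W n" if "n \<le> m" for n m
    using lift_Suc_antimono_le[of W, OF W_Suc that] .
  have W_left: "c j * u \<in> W n" and W_right: "u * c j \<in> W n"
    if u: "u \<in> W (Suc (max n j))" for u n j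
  proof -
    obtain r where "u \<in> words c x (Suc (max n j)) r" using u unfolding W_def by blast
    then have "c j * u \<in> W (max n j)" "u * c j \<in> W (max n j)"
      using step[of "max n j" r] by (force simp: word_step_def)+
    then show "c j * u \<in> W n" "u * c j \<in> W n" using W_dec[of n "max n j"] by auto
  qed
  define U where "U n = {u. \<exists>w\<in>W n. d u w < \<epsilon> / 2 ^ n}" for n
  have U_dec: "U m \<subseteq> U n" if "n \<le> m" for n m
  proof -
    have "\<epsilon> / 2 ^ m \<le> \<epsilon> / 2 ^ n"
      using that o(2) by (intro divide_left_mono) auto
    then have "d u w < \<epsilon> / 2 ^ n" if "d u w < \<epsilon> / 2 ^ m" for u w
      using that by linarith
    then show ?thesis using W_dec[OF that] unfolding U_def by blast
  qed
  have dd: "d (u * v) (u' * v') < \<epsilon> / 2 ^ n"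
    if "d u u' < \<epsilon> / 2 ^ Suc n" "d v v' < \<epsilon> / 2 ^ Suc n" for u v u' v' n
    using subinvariant_mult2[OF d(1,3), of u v u' v'] that by simp
  have U_mult: "u * v \<in> U n" if "u \<in> U (Suc n)" "v \<in> U (Suc n)" for u v n
    using that dd W_mult unfolding U_def mem_Collect_eq by meson
  \<comment> \<open>Replace \<open>a\<close> by a nearby \<open>c j\<close>, which may multiply words of level above \<open>j\<close>.\<close>
  have U_scale: "\<exists>m. \<forall>u\<in>U m. a * u \<in> U n \<and> u * a \<in> U n" for a n
  proof -
    obtain j where j: "d a (c j) < \<epsilon> / 2 ^ Suc n"
      using C(2)[of "\<epsilon> / 2 ^ Suc n" a] o(2) range_c by auto
    have "a * u \<in> U n \<and> u * a \<in> U n" if u: "u \<in> U (Suc (max n j))" for u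
    proof -
      obtain w where w: "w \<in> W (Suc (max n j))" "d u w < \<epsilon> / 2 ^ Suc (max n j)"
        using u unfolding U_def by blast
      have "\<epsilon> / 2 ^ Suc (max n j) \<le> \<epsilon> / 2 ^ Suc n"
        using o(2) by (intro divide_left_mono power_increasing) auto
      then have "d u w < \<epsilon> / 2 ^ Suc n" using w(2) by linarith
      then show ?thesis
        using dd[OF j, of u w] dd[OF _ j, of u w] W_left[OF w(1)] W_right[OF w(1)]
        unfolding U_def by blast
    qed
    then show ?thesis by blast
  qed
  have "(\<Inter>n. U n) \<noteq> {}"
  proof (rule zero_closed_no_vanishing_sequence[OF zc])
    show "decseq U" using U_dec by (simp add: decseq_def)
    show "U n \<noteq> {}" for n
    proof -
      have "d (x n) (x n) < \<epsilon> / 2 ^ n"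
        using d(1) o(2) unfolding pseudometric_def by simp
      then have "x n \<in> U n"
        using W_x[of n] unfolding U_def by blast
      then show ?thesis by blast
    qed
  qed (use U_mult U_scale in blast)+
  \<comment> \<open>Since \<open>p\<close> is a multiple of every element, a common point of the \<open>U n\<close> would bring \<open>p\<close> into \<open>U 0\<close>,
    that is, some word into the ball.\<close>
  then obtain a where a: "\<And>n. a \<in> U n" by blast
  obtain u v where p: "p = u * a * v" using o(1) unfolding I by blast
  obtain m where "\<forall>y\<in>U m. y * v \<in> U 0" using U_scale by blast
  moreover obtain l where "\<forall>y\<in>U l. u * y \<in> U m" using U_scale by blast
  ultimately have "p \<in> U 0" using a p by simp
  then obtain w r where w: "w \<in> words c x 0 r" "d p w < \<epsilon>"
    unfolding U_def W_def by auto
  have "w \<in> I" using WI w(1) unfolding W_def by blast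
  then show False
    using x(2)[of r] w d(1) unfolding pseudometric_def by fastforce
qed

theorem theorem2:
  fixes I :: "'a::semigroup_mult set"
  assumes "zero_closed TYPE('a)"
    and "I = (\<Inter>a. {x * a * y | x y. True})"
  shows "polybounded (UNIV :: 'a set) \<longleftrightarrow>
    (\<exists>d :: 'a \<Rightarrow> 'a \<Rightarrow> real.
       pseudometric d \<and> separable_pseudometric d \<and> subinvariant d \<and>
       (\<exists>c\<in>I. \<exists>\<epsilon>>0. polybounded {x\<in>I. d x c < \<epsilon>}))"
    (is "_ \<longleftrightarrow> ?R")
proof
  assume pb: "polybounded (UNIV :: 'a set)"
  then obtain c where c: "c \<in> I"
    using polybounded_imp_core_nonempty assms(2) by blast
  have "pseudometric (\<lambda>_ _::'a. 0)" "subinvariant (\<lambda>_ _::'a. 0)"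
    by (simp_all add: pseudometric_def subinvariant_def)
  moreover have "separable_pseudometric (\<lambda>_ _::'a. 0)"
    unfolding separable_pseudometric_def by (rule exI[of _ "{c}"]) simp
  moreover have "polybounded {x\<in>I. (0::real) < 1}"
    using pb by (rule polybounded_subset) simp
  ultimately show ?R
    using c zero_less_one by (intro exI[of _ "\<lambda>_ _. 0"]) blast
next
  assume ?R
  then obtain d c \<epsilon> where "pseudometric d" "separable_pseudometric d" "subinvariant d"
    and c: "c \<in> I" and "\<epsilon> > 0" "polybounded {x\<in>I. d x c < \<epsilon>}"
    by blast
  then have "polybounded I"
    using zero_closed_polybounded_core[OF assms] by blast
  moreover have "poly_map 1 (\<lambda>x. Inj1 (x * c))"
    using poly_map_mult[OF poly_map_Inj1 poly_map_const[of "Inj1 c"]] by simp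
  ultimately have "polybounded ((\<lambda>x. x * c) -` I)"
    by (rule polybounded_vimage) simp
  moreover have "x * c \<in> I" for x
    using c unfolding assms(2) by (rule core_ideal)
  then have "(\<lambda>x. x * c) -` I = UNIV" by blast
  ultimately show "polybounded (UNIV :: 'a set)" by simp
qed

end
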